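(* Let $\Gamma$ be a finite group and let $G$ be a finite undirected multigraph with vertices $v_1,\dots,v_n$, each vertex $v_i$ being decorated with an element $t_i\in\Gamma$, such that $\{t_1,\dots,t_n\}$ generates $\Gamma$. Assume that: (1) the adjacency matrix $A(G)$ is a Perron–Frobenius matrix, i.e. it has a unique eigenvalue of maximal modulus and some power $A(G)^k$ has all entries positive; (2) for every nontrivial one-dimensional unitary representation $\rho$ of $\Gamma$ there exist $1\le i,j\le n$ such that $\rho(t_i)\ne\rho(t_j)$. Then the distributions $P_N$ on $\Gamma$ (the distribution of the product of the decorations along a uniformly random walk of length $N$ on $G$) converge to the uniform distribution on $\Gamma$ as $N\to\infty$. Furthermore, there is a constant $c<1$, depending only on $G$, $\Gamma$ and the assignment $T: v_i\mapsto t_i$, such that for all $N\ge 1$ and all $\gamma\in\Gamma$ $$p_N(\gamma)-\frac{1}{|\Gamma|}<c^N .$$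
   Context: A walk $w=(v_{i_1},v_{i_2},\dots,v_{i_k})$ on $G$ is a sequence of vertices with consecutive vertices joined by an edge (loops are allowed, and walks are counted with edge multiplicity if $G$ has multiple edges); its length is taken to be the number $k$ of vertices listed. To $w$ one associates $\gamma_w=t_{i_k}\cdots t_{i_2}t_{i_1}\in\Gamma$. $W_N$ is the set of all walks of length $N$ on $G$. $P_N$ is the probability distribution on $\Gamma$ with density $p_N(\gamma)=|\{w\in W_N : \gamma_w=\gamma\}|/|W_N|$. *)

theory Defs
  imports
    "HOL-Analysis.Nonnegative_Lebesgue_Integration"
    "HOL-Algebra.Generated_Groups"
    "HOL-Library.Uprod"
    "Jordan_Normal_Form.Char_Poly"
begin

(* Undirected multigraphs on the vertices 0, ..., n - 1 (the vertex v_i is the number i - 1).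
   A loop is an edge e with ends e = Upair i i. *)

record 'e multigraph =
  nverts :: nat
  edges :: "'e set"
  ends :: "'e \<Rightarrow> nat uprod"

definition finite_multigraph :: "'e multigraph \<Rightarrow> bool" where
  "finite_multigraph G \<longleftrightarrow>
     finite (edges G) \<and> (\<forall>e\<in>edges G. set_uprod (ends G e) \<subseteq> {..<nverts G})"

(* A loop contributes 1 to the diagonal: it can be traversed in one way from its vertex,
   so that the entries of powers of the matrix count walks. *)

definition adjacency_matrix :: "'e multigraph \<Rightarrow> real mat" where
  "adjacency_matrix G =
     mat (nverts G) (nverts G) (\<lambda>(i, j). real (card {e \<in> edges G. ends G e = Upair i j}))"

(* Eigenvalues are complex. The exponent must be positive: otherwise every 1 x 1 matrix,
   including the zero matrix, would satisfy the second condition. *)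

definition perron_frobenius_matrix :: "real mat \<Rightarrow> bool" where
  "perron_frobenius_matrix A \<longleftrightarrow>
     (\<exists>!z. eigenvalue (map_mat complex_of_real A) z \<and>
           (\<forall>w. eigenvalue (map_mat complex_of_real A) w \<longrightarrow> cmod w \<le> cmod z)) \<and>
     (\<exists>k>0. \<forall>i<dim_row A. \<forall>j<dim_col A. (A ^\<^sub>m k) $$ (i, j) > 0)"

(* The length N of a walk is its number of vertices. A walk records the edges it
   traverses as well as its vertices, so that parallel edges give different walks. *)

definition walks :: "'e multigraph \<Rightarrow> nat \<Rightarrow> (nat list \<times> 'e list) set" where
  "walks G N = {(vs, es).
     length vs = N \<and> length vs = Suc (length es) \<and>
     set vs \<subseteq> {..<nverts G} \<and> set es \<subseteq> edges G \<and>
     (\<forall>i<length es. ends G (es ! i) = Upair (vs ! i) (vs ! Suc i))}"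

(* For a walk through v_1, ..., v_k this is t v_k * ... * t v_2 * t v_1. *)

definition walk_product ::
    "('g, 'b) monoid_scheme \<Rightarrow> (nat \<Rightarrow> 'g) \<Rightarrow> nat list \<times> 'e list \<Rightarrow> 'g" where
  "walk_product \<Gamma> t w = fold (\<lambda>v g. t v \<otimes>\<^bsub>\<Gamma>\<^esub> g) (fst w) \<one>\<^bsub>\<Gamma>\<^esub>"

definition walk_density ::
    "('g, 'b) monoid_scheme \<Rightarrow> 'e multigraph \<Rightarrow> (nat \<Rightarrow> 'g) \<Rightarrow> nat \<Rightarrow> 'g \<Rightarrow> real" where
  "walk_density \<Gamma> G t N g =
     real (card {w \<in> walks G N. walk_product \<Gamma> t w = g}) / real (card (walks G N))"

definition walk_distribution ::
    "('g, 'b) monoid_scheme \<Rightarrow> 'e multigraph \<Rightarrow> (nat \<Rightarrow> 'g) \<Rightarrow> nat \<Rightarrow> 'g measure" where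
  "walk_distribution \<Gamma> G t N =
     point_measure (carrier \<Gamma>) (\<lambda>g. ennreal (walk_density \<Gamma> G t N g))"

(* The unitary group U(1). *)

definition circle_group :: "complex monoid" where
  "circle_group = \<lparr>carrier = {z. cmod z = 1}, mult = (*), one = 1\<rparr>"

definition one_dim_unitary_rep :: "('g, 'b) monoid_scheme \<Rightarrow> ('g \<Rightarrow> complex) \<Rightarrow> bool" where
  "one_dim_unitary_rep \<Gamma> \<rho> \<longleftrightarrow> \<rho> \<in> hom \<Gamma> circle_group"

definition nontrivial_rep :: "('g, 'b) monoid_scheme \<Rightarrow> ('g \<Rightarrow> complex) \<Rightarrow> bool" where
  "nontrivial_rep \<Gamma> \<rho> \<longleftrightarrow> (\<exists>g\<in>carrier \<Gamma>. \<rho> g \<noteq> 1)"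

end

theory Submission
  imports Defs "HOL-Algebra.Multiplicative_Group"
begin

text \<open>
  Let \<open>V\<close> be the vertex set of \<open>G\<close>. Reading a walk vertex by vertex while multiplying up its
  decorations is a walk on the skew product: the directed graph with vertex set \<open>V \<times> \<Gamma>\<close> and an
  arrow from \<open>(i, h)\<close> to \<open>(j, t\<^sub>j h)\<close> for every edge joining \<open>i\<close> and \<open>j\<close>. Let \<open>a\<^sub>N(j, g)\<close> be the
  number of walks of length \<open>N\<close> that end in \<open>j\<close> and have product \<open>g\<close>, and let \<open>u\<^sub>N(j, g)\<close> be the mean
  of \<open>a\<^sub>N(j, h)\<close> over all \<open>h \<in> \<Gamma>\<close>. Then \<open>a\<close> and \<open>u\<close> satisfy the same linear recurrence, given by the
  nonnegative kernel of the skew product, and the difference \<open>a\<^sub>N - u\<^sub>N\<close> has sum \<open>0\<close>. Since \<open>u\<^sub>N\<close>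
  is constant in \<open>g\<close>, it suffices that this difference is exponentially small relative to \<open>u\<^sub>N\<close>.

  The skew product is primitive: for some \<open>m\<close>, every state reaches every state in exactly \<open>m\<close>
  steps. Representation theory would show this by excluding eigenvalues of maximal modulus for
  the adjacency operators twisted by nontrivial irreducible representations; the argument below (\<open>sources_full\<close>) is combinatorial. For a fixed
  target state and a vertex \<open>i\<close>, consider the set of all \<open>h\<close> for which \<open>(i, h)\<close> reaches the target
  in exactly \<open>m\<close> steps. Passing from a vertex to a neighbour translates such a set into the one for
  \<open>m + 1\<close>, so for large \<open>m\<close> all these sets have the same size and the translations are equalities.
  As \<open>G\<close> is undirected, the neighbours of a vertex then share their set, and since any two vertices
  are joined by a walk of even length, the set is the same at all vertices. The group elements that
  stabilise it for every large \<open>m\<close> form a normal subgroup containing all \<open>t\<^sub>i t\<^sub>j\<^sup>-\<^sup>1\<close>. Modulo this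
  subgroup \<open>\<Gamma>\<close> is cyclic and all decorations coincide, so a faithful character of the quotient is a
  one-dimensional representation that does not separate the decorations; hence the quotient
  is trivial (\<open>normal_subgroup_eq_carrier\<close>), and the sets are all of \<open>\<Gamma>\<close>.

  Primitivity makes the \<open>m\<close>-th power of the kernel operator bounded below by a multiple of the
  total mass. This lower bound, applied to \<open>c u\<^sub>N + (a\<^sub>N - u\<^sub>N)\<close> and \<open>c u\<^sub>N - (a\<^sub>N - u\<^sub>N)\<close>, shows that
  the best constant \<open>c\<close> with \<open>\<bar>a\<^sub>N - u\<^sub>N\<bar> \<le> c u\<^sub>N\<close> shrinks by a fixed factor every \<open>m\<close> steps
  (\<open>contraction\<close>, \<open>geometric_domination\<close>).
\<close>

section \<open>Characters and normal subgroups with cyclic quotient\<close>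

lemma (in group) cyclic_group_faithful_character:
  assumes fin: "finite (carrier G)" and a: "a \<in> carrier G"
    and gen: "generate G {a} = carrier G"
  shows "\<exists>\<rho>\<in>hom G circle_group. \<rho> a = cis (2 * pi / real (ord a))"
proof -
  define q where "q = ord a"
  have q: "q > 0" using ord_ge_1[OF fin a] by (simp add: q_def)
  \<comment> \<open>Any discrete logarithm will do: two of them differ by a multiple of the order of \<open>a\<close>.\<close>
  define dlog :: "'a \<Rightarrow> int" where "dlog x = (SOME k. a [^] k = x)" for x
  define \<rho> where "\<rho> x = cis (2 * pi * (real_of_int (dlog x) / real q))" for x
  have key: "\<rho> (a [^] k) = cis (2 * pi * (real_of_int k / real q))" for k :: int
  proof -
    have "a [^] dlog (a [^] k) = a [^] k"
      unfolding dlog_def by (rule someI[of _ k]) simp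
    hence "int q dvd dlog (a [^] k) - k"
      using int_pow_eq[OF a, of k "dlog (a [^] k)"] by (simp add: q_def)
    then obtain m where m: "dlog (a [^] k) = k + int q * m"
      by (auto simp: dvd_def algebra_simps)
    have "real_of_int (dlog (a [^] k)) / real q = real_of_int k / real q + real_of_int m"
      using q by (simp add: m field_simps)
    hence "\<rho> (a [^] k) = cis (2 * pi * (real_of_int k / real q) + 2 * pi * real_of_int m)"
      by (simp only: \<rho>_def distrib_left)
    thus ?thesis by (simp add: cis_mult[symmetric] cis_multiple_2pi)
  qed
  have pow: "\<exists>k::int. x = a [^] k" if "x \<in> carrier G" for x
    using that generate_pow[OF a] gen by auto
  have "\<rho> \<in> hom G circle_group"
  proof (rule homI)
    show "\<rho> x \<in> carrier circle_group" for x by (simp add: circle_group_def \<rho>_def)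
    fix x y assume "x \<in> carrier G" "y \<in> carrier G"
    then obtain k l :: int where kl: "x = a [^] k" "y = a [^] l" using pow by metis
    have "x \<otimes> y = a [^] (k + l)" using a by (simp add: kl int_pow_mult)
    thus "\<rho> (x \<otimes> y) = \<rho> x \<otimes>\<^bsub>circle_group\<^esub> \<rho> y"
      unfolding kl by (simp only: key) (simp add: circle_group_def cis_mult add_divide_distrib distrib_left)
  qed
  moreover have "\<rho> a = cis (2 * pi / real q)"
    using key[of 1] a by (simp add: int_pow_1)
  ultimately show ?thesis by (auto simp: q_def)
qed

text \<open>
  The quotient by \<open>H\<close> is generated by the common coset of the elements of \<open>S\<close>, hence cyclic. Its
  faithful character, pulled back to \<open>G\<close>, is constant on \<open>S\<close>, and by hypothesis this
  is possible only for the trivial one; so the coset has order \<open>1\<close>.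
\<close>
lemma (in group) normal_subgroup_eq_carrier:
  assumes fin: "finite (carrier G)" and S: "S \<subseteq> carrier G" and gen: "generate G S = carrier G"
    and H: "H \<lhd> G" and SH: "\<And>x y. x \<in> S \<Longrightarrow> y \<in> S \<Longrightarrow> x \<otimes> inv y \<in> H"
    and sep: "\<And>\<rho>. \<rho> \<in> hom G circle_group \<Longrightarrow> \<exists>g\<in>carrier G. \<rho> g \<noteq> 1 \<Longrightarrow>
                 \<exists>x\<in>S. \<exists>y\<in>S. \<rho> x \<noteq> \<rho> y"
  shows "H = carrier G"
proof (cases "S = {}")
  case True
  hence "carrier G = {\<one>}" using gen generate_empty by simp
  thus ?thesis
    using subgroup.one_closed[OF normal_imp_subgroup[OF H]] subgroup.subset[OF normal_imp_subgroup[OF H]]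
    by auto
next
  case False
  then obtain a where a: "a \<in> S" by auto
  hence aG: "a \<in> carrier G" using S by auto
  have sub: "subgroup H G" using H by (rule normal_imp_subgroup)
  define Q where "Q = G Mod H"
  interpret Q: group Q unfolding Q_def by (rule normal.factorgroup_is_group[OF H])
  interpret \<pi>: group_hom G Q "\<lambda>g. H #> g"
    unfolding group_hom_def group_hom_axioms_def Q_def
    using normal.r_coset_hom_Mod[OF H] normal.factorgroup_is_group[OF H] by (auto intro: is_group)
  have finQ: "finite (carrier Q)" and cQ: "carrier Q = (\<lambda>g. H #> g) ` carrier G"
    using fin by (auto simp: Q_def FactGroup_def RCOSETS_def)
  define c where "c = H #> a"
  have c: "H #> x = c" if "x \<in> S" for x
    using coset_join3 SH[OF that a] that S aG sub unfolding c_def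
    by (metis coset_mult_inv1 subgroup.subset subsetD coset_mult_assoc inv_closed coset_join2 subgroup.mem_carrier)
  hence "(\<lambda>g. H #> g) ` S = {c}" using a by auto
  hence genQ: "generate Q {c} = carrier Q"
    using \<pi>.generate_img[OF S] gen cQ by simp
  have cin: "c \<in> carrier Q" using aG cQ by (auto simp: c_def)
  obtain \<rho> where \<rho>: "\<rho> \<in> hom Q circle_group" "\<rho> c = cis (2 * pi / real (Q.ord c))"
    using Q.cyclic_group_faithful_character[OF finQ cin genQ] by auto
  have "\<rho> \<circ> (\<lambda>g. H #> g) \<in> hom G circle_group"
    by (rule Group.hom_compose[OF \<pi>.homh \<rho>(1)])
  from sep[OF this] have "\<rho> (H #> g) = 1" if "g \<in> carrier G" for g
    using that c by fastforce
  hence "cis (2 * pi / real (Q.ord c)) = 1" using aG \<rho>(2) by (auto simp: c_def)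
  hence "cos (2 * pi / real (Q.ord c)) = 1" by (metis cis.sel(1) one_complex.sel(1))
  then obtain m :: int where "2 * pi / real (Q.ord c) = of_int m * 2 * pi"
    using cos_one_2pi_int by auto
  hence m: "1 = of_int m * real (Q.ord c)"
    using Q.ord_ge_1[OF finQ cin] by (simp add: field_simps)
  hence "1 = m * int (Q.ord c)" by (metis of_int_eq_1_iff of_int_mult of_int_of_nat_eq)
  hence "Q.ord c = 1" by (metis dvd_triv_right int_dvd_int_iff nat_dvd_1_iff_1 of_nat_1)
  hence "c = \<one>\<^bsub>Q\<^esub>" using Q.pow_ord_eq_1[OF cin] cin by simp
  hence "carrier Q = {\<one>\<^bsub>Q\<^esub>}" using genQ Q.generate_one by simp
  moreover have "H #> g \<in> carrier Q" if "g \<in> carrier G" for g using that cQ by blast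
  moreover have "\<one>\<^bsub>Q\<^esub> = H" by (simp add: Q_def FactGroup_def)
  ultimately have "H #> g = H" if "g \<in> carrier G" for g using that by blast
  hence "g \<in> H" if "g \<in> carrier G" for g using rcos_self[OF that sub] that by simp
  thus ?thesis using subgroup.subset[OF sub] by auto
qed

text \<open>
  Conjugation by a generator is an injective self-map of the finite set \<open>H\<close>, hence a bijection.
  So conjugation by the inverse of a generator preserves \<open>H\<close> as well.
\<close>
lemma (in group) normal_if_generators_conjugate:
  assumes fin: "finite (carrier G)" and S: "S \<subseteq> carrier G" and gen: "generate G S = carrier G"
    and H: "subgroup H G" and conj: "\<And>s h. s \<in> S \<Longrightarrow> h \<in> H \<Longrightarrow> s \<otimes> h \<otimes> inv s \<in> H"
  shows "H \<lhd> G"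
proof -
  note HG = subgroup.mem_carrier[OF H]
  have inv_conj: "inv s \<otimes> h \<otimes> s \<in> H" if s: "s \<in> S" and h: "h \<in> H" for s h
  proof -
    have sG: "s \<in> carrier G" using s S by auto
    let ?f = "\<lambda>x. s \<otimes> x \<otimes> inv s"
    have "inj_on ?f H" using sG HG by (auto intro!: inj_onI)
    moreover have "?f ` H \<subseteq> H" using conj[OF s] by auto
    moreover have "finite H" using fin subgroup.subset[OF H] by (rule finite_subset[rotated])
    ultimately have "?f ` H = H" by (simp add: endo_inj_surj)
    then obtain x where x: "x \<in> H" "h = s \<otimes> x \<otimes> inv s" using h by blast
    hence "inv s \<otimes> h \<otimes> s = x" using sG HG by (simp add: m_assoc inv_solve_left')
    thus ?thesis using x by simp
  qed
  have "\<forall>h\<in>H. x \<otimes> h \<otimes> inv x \<in> H" if "x \<in> generate G S" for x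
    using that
  proof induction
    case one
    then show ?case using HG by simp
  next
    case (incl s)
    then show ?case using conj by blast
  next
    case (inv s)
    then show ?case using inv_conj S by auto
  next
    case (eng x y)
    have "x \<in> carrier G" "y \<in> carrier G" using eng gen by auto
    hence "x \<otimes> y \<otimes> h \<otimes> inv (x \<otimes> y) = x \<otimes> (y \<otimes> h \<otimes> inv y) \<otimes> inv x" if "h \<in> H" for h
      using that HG by (simp add: m_assoc inv_mult_group)
    then show ?case using eng.IH by simp
  qed
  thus ?thesis using H gen by (simp add: normal_inv_iff)
qed

section \<open>Primitivity of the skew product\<close>

text \<open>
  Since \<open>E ^^ k\<close> is everything and \<open>k > 0\<close>, each point has a predecessor, so full powers stay full.
\<close>
lemma relpow_full_mono:
  assumes E: "E \<subseteq> V \<times> V" and k: "k > 0" "E ^^ k = V \<times> V" and "m \<ge> k"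
  shows "E ^^ m = V \<times> V"
  using \<open>m \<ge> k\<close>
proof (induction m rule: dec_induct)
  case base
  show ?case by (rule k)
next
  case (step m)
  have "\<exists>i. (i, j) \<in> E" if "j \<in> V" for j
  proof -
    have "(j, j) \<in> E ^^ Suc (k - 1)" using k that by simp
    thus ?thesis by auto
  qed
  hence "V \<times> V \<subseteq> (V \<times> V) O E" using E by fastforce
  moreover have "(V \<times> V) O E \<subseteq> V \<times> V" using E by auto
  ultimately show ?case using step.IH by simp
qed

text \<open>
  The assumption \<open>one_coset\<close> is the group-theoretic form in which the condition on characters
  enters: no proper normal subgroup has a single coset containing all decorations.
\<close>
locale skew_product = group \<Gamma> for \<Gamma> :: "('g, 'b) monoid_scheme" (structure) +
  fixes V :: "'v set" and E :: "('v \<times> 'v) set" and t :: "'v \<Rightarrow> 'g" and k :: nat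
  assumes finite_carrier: "finite (carrier \<Gamma>)"
    and finite_V: "finite V"
    and E_subset: "E \<subseteq> V \<times> V" and sym_E: "sym E"
    and k_pos: "k > 0" and E_primitive: "E ^^ k = V \<times> V"
    and t_subset: "t ` V \<subseteq> carrier \<Gamma>"
    and gen: "generate \<Gamma> (t ` V) = carrier \<Gamma>"
    and one_coset: "\<And>H. H \<lhd> \<Gamma> \<Longrightarrow> (\<And>i j. i \<in> V \<Longrightarrow> j \<in> V \<Longrightarrow> t i \<otimes> inv (t j) \<in> H) \<Longrightarrow>
                      H = carrier \<Gamma>"
begin

definition step :: "(('v \<times> 'g) \<times> ('v \<times> 'g)) set" where
  "step = {((i, h), (j, t j \<otimes> h)) | i j h. (i, j) \<in> E \<and> h \<in> carrier \<Gamma>}"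

text \<open>The fibre over \<open>i\<close> of the set of states that reach \<open>y\<close> in exactly \<open>m\<close> steps.\<close>
definition sources :: "'v \<times> 'g \<Rightarrow> nat \<Rightarrow> 'v \<Rightarrow> 'g set" where
  "sources y m i = {h \<in> carrier \<Gamma>. ((i, h), y) \<in> step ^^ m}"

lemma t_in: "i \<in> V \<Longrightarrow> t i \<in> carrier \<Gamma>"
  using t_subset by auto

lemma finite_sources: "finite (sources y m i)"
  using finite_carrier by (simp add: sources_def)

lemma sources_carrier: "h \<in> sources y m i \<Longrightarrow> h \<in> carrier \<Gamma>"
  by (simp add: sources_def)

lemma sources_step:
  assumes "(i, j) \<in> E" "h \<in> carrier \<Gamma>" "t j \<otimes> h \<in> sources y m j"
  shows "h \<in> sources y (Suc m) i"
proof -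
  have "((i, h), (j, t j \<otimes> h)) \<in> step" using assms by (auto simp: step_def)
  thus ?thesis using assms relpow_Suc_I2 by (fastforce simp: sources_def)
qed

lemma image_sources:
  assumes "(i, j) \<in> E"
  shows "(\<lambda>h. inv (t j) \<otimes> h) ` sources y m j \<subseteq> sources y (Suc m) i"
    and "inj_on (\<lambda>h. inv (t j) \<otimes> h) (sources y m j)"
proof -
  have t: "t j \<in> carrier \<Gamma>" using assms E_subset t_in by auto
  have "inv (t j) \<otimes> h \<in> sources y (Suc m) i" if h: "h \<in> sources y m j" for h
  proof (rule sources_step[OF assms])
    have hG: "h \<in> carrier \<Gamma>" using h by (simp add: sources_def)
    then show "inv (t j) \<otimes> h \<in> carrier \<Gamma>" using t by simp
    have "t j \<otimes> (inv (t j) \<otimes> h) = h" using t hG by (simp add: m_assoc[symmetric])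
    then show "t j \<otimes> (inv (t j) \<otimes> h) \<in> sources y m j" using h by simp
  qed
  thus "(\<lambda>h. inv (t j) \<otimes> h) ` sources y m j \<subseteq> sources y (Suc m) i" by auto
  show "inj_on (\<lambda>h. inv (t j) \<otimes> h) (sources y m j)"
    using t by (auto intro!: inj_onI simp: sources_def)
qed

lemma card_sources_mono:
  assumes "(i, j) \<in> E ^^ l"
  shows "card (sources y m j) \<le> card (sources y (m + l) i)"
  using assms
proof (induction l arbitrary: i)
  case (Suc l)
  then obtain i' where i': "(i, i') \<in> E" "(i', j) \<in> E ^^ l" by (meson relpow_Suc_D2)
  have "card (sources y m j) \<le> card (sources y (m + l) i')" using Suc.IH i' by simp
  also have "\<dots> \<le> card (sources y (Suc (m + l)) i)"
    using image_sources[OF i'(1)] finite_sources by (metis card_image card_mono)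
  finally show ?case by simp
qed simp

text \<open>
  The sizes are bounded by the order of the group, so they attain a maximum at some \<open>m1\<close> and \<open>i1\<close>.
  From every vertex and for every \<open>l \<ge> k\<close> there is a walk of length \<open>l\<close> to \<open>i1\<close>, along which sizes
  do not drop, so the maximum is attained everywhere from \<open>m1 + k\<close> on.
\<close>
lemma card_sources_stable:
  assumes y: "y \<in> V \<times> carrier \<Gamma>"
  shows "\<exists>m0 c. c > 0 \<and> (\<forall>m\<ge>m0. \<forall>i\<in>V. card (sources y m i) = c)"
proof -
  let ?Q = "\<lambda>(m, i). i \<in> V" and ?card = "\<lambda>(m, i). card (sources y m i)"
  obtain l g where lg: "y = (l, g)" "l \<in> V" "g \<in> carrier \<Gamma>" using y by auto
  have bound: "card (sources y m i) < Suc (card (carrier \<Gamma>))" for m i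
    using finite_carrier by (auto simp: sources_def less_Suc_eq_le intro!: card_mono)
  obtain p where p: "?Q p" and max: "\<And>p'. ?Q p' \<Longrightarrow> ?card p' \<le> ?card p"
    using ex_has_greatest_nat[of ?Q "(0, l)" ?card "Suc (card (carrier \<Gamma>))"] bound lg(2) by fastforce
  obtain m1 i1 where p_eq: "p = (m1, i1)" by fastforce
  define c where "c = card (sources y m1 i1)"
  have i1: "i1 \<in> V" using p p_eq by simp
  have le: "card (sources y m i) \<le> c" if "i \<in> V" for m i
    using max[of "(m, i)"] that by (simp add: c_def p_eq)
  have "sources y 0 l = {g}" using lg by (auto simp: sources_def)
  hence "c > 0" using le[of l 0] lg by simp
  moreover have "card (sources y m i) = c" if m: "m \<ge> m1 + k" and i: "i \<in> V" for m i
  proof (rule antisym[OF le[OF i]])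
    have "(i, i1) \<in> E ^^ (m - m1)"
      using relpow_full_mono[OF E_subset k_pos E_primitive, of "m - m1"] m i i1 by simp
    from card_sources_mono[OF this, of y m1] show "c \<le> card (sources y m i)"
      using m by (simp add: c_def)
  qed
  ultimately show ?thesis by blast
qed

text \<open>
  Once the sizes have stabilised, the inclusions between the translated sets are equalities
  (\<open>rigid\<close>). Two neighbours of one vertex thus have the same set; iterating along walks of even
  length, which exist between any two vertices, gives one set \<open>P m\<close> for all vertices, with
  \<open>P (m + 1)\<close> the translate of \<open>P m\<close> by the inverse of an arbitrary decoration. The stabiliser \<open>H\<close>
  below is taken simultaneously for all large \<open>m\<close>: conjugating by a decoration shifts \<open>m\<close> by one,
  and with this definition \<open>H\<close> is invariant under the shift.
\<close>
lemma sources_full: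
  assumes y: "y \<in> V \<times> carrier \<Gamma>"
  shows "\<exists>m1. \<forall>m\<ge>m1. \<forall>i\<in>V. sources y m i = carrier \<Gamma>"
proof -
  obtain m0 c where c: "c > 0" and card: "\<And>m i. m \<ge> m0 \<Longrightarrow> i \<in> V \<Longrightarrow> card (sources y m i) = c"
    using card_sources_stable[OF y] by blast
  have rigid: "h \<in> sources y (Suc m) i \<longleftrightarrow> t j \<otimes> h \<in> sources y m j"
    if m: "m \<ge> m0" and ij: "(i, j) \<in> E" and h: "h \<in> carrier \<Gamma>" for m i j h
  proof
    have V: "i \<in> V" "j \<in> V" using ij E_subset by auto
    note tj = t_in[OF V(2)]
    assume "h \<in> sources y (Suc m) i"
    moreover have "(\<lambda>h. inv (t j) \<otimes> h) ` sources y m j = sources y (Suc m) i"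
      using image_sources[OF ij] card m V
      by (intro card_subset_eq finite_sources) (auto simp: card_image)
    ultimately obtain h' where h': "h' \<in> sources y m j" "h = inv (t j) \<otimes> h'" by auto
    hence "t j \<otimes> h = h'" using tj by (simp add: sources_def m_assoc[symmetric])
    thus "t j \<otimes> h \<in> sources y m j" using h' by simp
  qed (use sources_step that in blast)
  \<comment> \<open>Symmetry of \<open>E\<close> is used here: both \<open>i\<close> and \<open>i''\<close> precede their common neighbour \<open>j\<close>.\<close>
  have E2: "sources y (Suc m) i = sources y (Suc m) i'"
    if m: "m \<ge> m0" and "(i, i') \<in> E ^^ (2 * l)" for m i i' l
    using that(2)
  proof (induction l arbitrary: i)
    case (Suc l)
    hence "(i, i') \<in> E ^^ Suc (Suc (2 * l))" by simp
    then obtain j i'' where j: "(i, j) \<in> E" "(j, i'') \<in> E" "(i'', i') \<in> E ^^ (2 * l)"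
      by (meson relpow_Suc_D2)
    have "sources y (Suc m) i = sources y (Suc m) i''"
      using rigid[OF m j(1)] rigid[OF m symD[OF sym_E j(2)]] sources_carrier by blast
    thus ?case using Suc.IH j by simp
  qed simp
  have same: "sources y (Suc m) i = sources y (Suc m) i'"
    if "m \<ge> m0" "i \<in> V" "i' \<in> V" for m i i'
    using E2[OF that(1), of i i' k] relpow_full_mono[OF E_subset k_pos E_primitive, of "2 * k"] that
    by simp
  obtain l where l: "l \<in> V" using y by auto
  define P where "P m = sources y m l" for m
  have P_eq: "sources y m i = P m" if "m > m0" "i \<in> V" for m i
    using same[of "m - 1" i l] that l by (simp add: P_def)
  have PG: "h \<in> carrier \<Gamma>" if "h \<in> P m" for h m using that by (simp add: P_def sources_def)
  have shift: "h \<in> P (Suc m) \<longleftrightarrow> t j \<otimes> h \<in> P m" if "m > m0" "j \<in> V" "h \<in> carrier \<Gamma>" for m j h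
  proof -
    have "(j, j) \<in> E ^^ Suc (k - 1)" using k_pos E_primitive that by simp
    then obtain i where "(i, j) \<in> E" by auto
    thus ?thesis using rigid[of m i j h] P_eq[of m j] P_eq[of "Suc m" i] E_subset that by auto
  qed
  define H where "H = {x \<in> carrier \<Gamma>. \<forall>m>m0. \<forall>h\<in>carrier \<Gamma>. h \<in> P m \<longleftrightarrow> x \<otimes> h \<in> P m}"
  have HG: "x \<in> carrier \<Gamma>" if "x \<in> H" for x using that by (simp add: H_def)
  have HP: "x \<otimes> h \<in> P m \<longleftrightarrow> h \<in> P m" if "x \<in> H" "m > m0" "h \<in> carrier \<Gamma>" for x m h
    using that by (simp add: H_def)
  have shift': "inv (t j) \<otimes> h \<in> P (Suc m) \<longleftrightarrow> h \<in> P m"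
    if "m > m0" "j \<in> V" "h \<in> carrier \<Gamma>" for m j h
    using shift[of m j "inv (t j) \<otimes> h"] that t_in[of j] by (simp add: m_assoc[symmetric])
  have "subgroup H \<Gamma>"
  proof (rule subgroupI)
    show "H \<subseteq> carrier \<Gamma>" by (auto simp: H_def)
    have "\<one> \<in> H" by (auto simp: H_def)
    thus "H \<noteq> {}" by auto
  next
    fix x assume x: "x \<in> H"
    have "h \<in> P m \<longleftrightarrow> inv x \<otimes> h \<in> P m" if "m > m0" "h \<in> carrier \<Gamma>" for m h
      using HP[OF x that(1), of "inv x \<otimes> h"] HG[OF x] that by (simp add: m_assoc[symmetric])
    thus "inv x \<in> H" using HG[OF x] by (simp add: H_def)
  next
    fix x z assume xz: "x \<in> H" "z \<in> H"
    have "h \<in> P m \<longleftrightarrow> x \<otimes> z \<otimes> h \<in> P m" if "m > m0" "h \<in> carrier \<Gamma>" for m h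
      using HP[OF xz(1) that(1), of "z \<otimes> h"] HP[OF xz(2) that] HG[OF xz(1)] HG[OF xz(2)] that
      by (simp add: m_assoc)
    thus "x \<otimes> z \<in> H" using HG[OF xz(1)] HG[OF xz(2)] by (simp add: H_def)
  qed
  moreover have "t j \<otimes> x \<otimes> inv (t j) \<in> H" if j: "j \<in> V" and x: "x \<in> H" for j x
  proof -
    have "h \<in> P m \<longleftrightarrow> t j \<otimes> x \<otimes> inv (t j) \<otimes> h \<in> P m" if m: "m > m0" "h \<in> carrier \<Gamma>" for m h
    proof -
      have "h \<in> P m \<longleftrightarrow> x \<otimes> (inv (t j) \<otimes> h) \<in> P (Suc m)"
        using HP[OF x, of "Suc m" "inv (t j) \<otimes> h"] shift'[OF m(1) j m(2)] m t_in[OF j] by simp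
      also have "\<dots> \<longleftrightarrow> t j \<otimes> (x \<otimes> (inv (t j) \<otimes> h)) \<in> P m"
        using shift[OF m(1) j] m t_in[OF j] HG[OF x] by simp
      finally show ?thesis using m t_in[OF j] HG[OF x] by (simp add: m_assoc)
    qed
    thus ?thesis using t_in[OF j] HG[OF x] by (simp add: H_def)
  qed
  ultimately have "H \<lhd> \<Gamma>"
    using normal_if_generators_conjugate[OF finite_carrier t_subset gen] by blast
  moreover have "t i \<otimes> inv (t j) \<in> H" if ij: "i \<in> V" "j \<in> V" for i j
  proof -
    have "h \<in> P m \<longleftrightarrow> t i \<otimes> inv (t j) \<otimes> h \<in> P m" if m: "m > m0" "h \<in> carrier \<Gamma>" for m h
      using shift[of m i "inv (t j) \<otimes> h"] shift'[of m j h] m ij t_in by (simp add: m_assoc)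
    thus ?thesis using t_in ij by (simp add: H_def)
  qed
  ultimately have H: "H = carrier \<Gamma>" by (rule one_coset)
  have "P m = carrier \<Gamma>" if m: "m > m0" for m
  proof -
    have "card (P m) > 0" using card[of m l] m l c by (simp add: P_def)
    then obtain h where h: "h \<in> P m" by (metis card_gt_0_iff ex_in_conv)
    have "x \<in> P m" if x: "x \<in> carrier \<Gamma>" for x
      using HP[of "x \<otimes> inv h" m h] H h PG[OF h] m x by (simp add: m_assoc)
    thus ?thesis using PG by auto
  qed
  thus ?thesis using P_eq by (metis Suc_le_eq)
qed

text \<open>There are finitely many targets, so one number of steps serves them all.\<close>
theorem step_primitive:
  "\<exists>m>0. \<forall>x\<in>V \<times> carrier \<Gamma>. \<forall>y\<in>V \<times> carrier \<Gamma>. (x, y) \<in> step ^^ m"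
proof -
  let ?X = "V \<times> carrier \<Gamma>"
  obtain m1 where m1: "\<And>y m i. y \<in> ?X \<Longrightarrow> m \<ge> m1 y \<Longrightarrow> i \<in> V \<Longrightarrow> sources y m i = carrier \<Gamma>"
    using sources_full by metis
  define M where "M = Suc (\<Sum>y\<in>?X. m1 y)"
  have "m1 y \<le> M" if "y \<in> ?X" for y
    using member_le_sum[OF that, of m1] finite_V finite_carrier by (simp add: M_def)
  hence "sources y M i = carrier \<Gamma>" if "y \<in> ?X" "i \<in> V" for y i
    using m1 that by blast
  hence "((i, h), y) \<in> step ^^ M" if "y \<in> ?X" "i \<in> V" "h \<in> carrier \<Gamma>" for y i h
    using that by (auto simp: sources_def)
  thus ?thesis by (intro exI[of _ M]) (auto simp: M_def)
qed

end

section \<open>Contraction under a primitive nonnegative kernel\<close>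

text \<open>
  The kernel transports mass forward: \<open>K y x\<close> is the weight of the arrow from \<open>y\<close> to \<open>x\<close>, so that
  the value at \<open>x\<close> collects what flows in from all \<open>y\<close>.
\<close>
definition apply_kernel :: "'x set \<Rightarrow> ('x \<Rightarrow> 'x \<Rightarrow> real) \<Rightarrow> ('x \<Rightarrow> real) \<Rightarrow> 'x \<Rightarrow> real" where
  "apply_kernel X K f x = (\<Sum>y\<in>X. K y x * f y)"

locale nonneg_kernel =
  fixes X :: "'x set" and K :: "'x \<Rightarrow> 'x \<Rightarrow> real"
  assumes finite_X: "finite X" and K_nonneg: "\<And>x y. K x y \<ge> 0"
begin

abbreviation T where "T \<equiv> apply_kernel X K"

definition support :: "('x \<times> 'x) set" where
  "support = {(y, x). y \<in> X \<and> x \<in> X \<and> K y x > 0}"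

lemma T_cong: "(\<And>x. x \<in> X \<Longrightarrow> f x = g x) \<Longrightarrow> T f x = T g x"
  by (simp add: apply_kernel_def)

lemma T_diff: "T (\<lambda>x. f x - g x) = (\<lambda>x. T f x - T g x)"
  by (simp add: apply_kernel_def fun_eq_iff algebra_simps sum_subtractf)

lemma T_scale: "T (\<lambda>x. c * f x) = (\<lambda>x. c * T f x)"
  by (simp add: apply_kernel_def fun_eq_iff sum_distrib_left algebra_simps)

lemma T_nonneg: "(\<And>x. x \<in> X \<Longrightarrow> f x \<ge> 0) \<Longrightarrow> T f x \<ge> 0"
  by (simp add: apply_kernel_def K_nonneg sum_nonneg)

lemma T_pow_nonneg: "(\<And>x. x \<in> X \<Longrightarrow> f x \<ge> 0) \<Longrightarrow> x \<in> X \<Longrightarrow> (T ^^ m) f x \<ge> 0"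
  by (induction m arbitrary: x) (auto intro: T_nonneg)

lemma T_pow_diff: "(T ^^ m) (\<lambda>x. f x - g x) = (\<lambda>x. (T ^^ m) f x - (T ^^ m) g x)"
  by (induction m) (simp_all add: T_diff)

lemma T_pow_scale: "(T ^^ m) (\<lambda>x. c * f x) = (\<lambda>x. c * (T ^^ m) f x)"
  by (induction m) (simp_all add: T_scale)

lemma T_pow_upper:
  "\<exists>M>0. \<forall>f. (\<forall>x\<in>X. f x \<ge> 0) \<longrightarrow> (\<forall>x\<in>X. (T ^^ m) f x \<le> M * sum f X)"
proof (induction m)
  case 0
  show ?case using member_le_sum[OF _ _ finite_X] by (intro exI[of _ 1]) auto
next
  case (Suc m)
  then obtain M where M: "M > 0" "\<And>f x. \<forall>x\<in>X. f x \<ge> 0 \<Longrightarrow> x \<in> X \<Longrightarrow> (T ^^ m) f x \<le> M * sum f X"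
    by blast
  define C where "C = (\<Sum>x\<in>X. \<Sum>y\<in>X. K y x)"
  have "(T ^^ Suc m) f x \<le> (M * (C + 1)) * sum f X" if f: "\<forall>x\<in>X. f x \<ge> 0" and x: "x \<in> X" for f x
  proof -
    have s: "sum f X \<ge> 0" using f by (simp add: sum_nonneg)
    have "(T ^^ Suc m) f x = (\<Sum>y\<in>X. K y x * (T ^^ m) f y)" by (simp add: apply_kernel_def)
    also have "\<dots> \<le> (\<Sum>y\<in>X. K y x * (M * sum f X))"
      by (intro sum_mono mult_left_mono M(2)[OF f] K_nonneg)
    also have "\<dots> = (\<Sum>y\<in>X. K y x) * (M * sum f X)" by (simp add: sum_distrib_right)
    also have "\<dots> \<le> (C + 1) * (M * sum f X)"
    proof (rule mult_right_mono)
      have "(\<Sum>y\<in>X. K y x) \<le> C"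
        unfolding C_def
        by (rule member_le_sum[OF x, of "\<lambda>x. \<Sum>y\<in>X. K y x"]) (auto simp: finite_X sum_nonneg K_nonneg)
      thus "(\<Sum>y\<in>X. K y x) \<le> C + 1" by simp
    qed (use M s in auto)
    finally show ?thesis by (simp add: algebra_simps)
  qed
  moreover have "M * (C + 1) > 0"
    using M(1) by (intro mult_pos_pos) (auto simp: C_def intro!: add_nonneg_pos sum_nonneg K_nonneg)
  ultimately show ?case by blast
qed

text \<open>The constant is the product of the positive weights along one path from \<open>y\<close> to \<open>x\<close>.\<close>
lemma T_pow_lower_path:
  assumes "(y, x) \<in> support ^^ m" and "y \<in> X"
  shows "\<exists>\<delta>>0. \<forall>f. (\<forall>x\<in>X. f x \<ge> 0) \<longrightarrow> (T ^^ m) f x \<ge> \<delta> * f y"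
  using assms(1)
proof (induction m arbitrary: x)
  case 0
  thus ?case by (intro exI[of _ 1]) auto
next
  case (Suc m)
  then obtain z where z: "(y, z) \<in> support ^^ m"
    and zx: "z \<in> X" "x \<in> X" "K z x > 0" by (auto simp: support_def)
  obtain \<delta> where \<delta>: "\<delta> > 0" "\<And>f. \<forall>x\<in>X. f x \<ge> 0 \<Longrightarrow> (T ^^ m) f z \<ge> \<delta> * f y"
    using Suc.IH[OF z] by blast
  have "(K z x * \<delta>) * f y \<le> (T ^^ Suc m) f x" if f: "\<forall>x\<in>X. f x \<ge> 0" for f
  proof -
    have "(K z x * \<delta>) * f y \<le> K z x * (T ^^ m) f z"
      using mult_left_mono[OF \<delta>(2)[OF f], of "K z x"] zx by (simp add: mult.assoc)
    also have "\<dots> \<le> (\<Sum>z\<in>X. K z x * (T ^^ m) f z)"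
      using f by (intro member_le_sum[OF zx(1), of "\<lambda>z. K z x * (T ^^ m) f z"])
        (auto simp: finite_X intro!: mult_nonneg_nonneg K_nonneg T_pow_nonneg)
    finally show ?thesis by (simp add: apply_kernel_def)
  qed
  thus ?case using \<delta>(1) zx(3) by (intro exI[of _ "K z x * \<delta>"]) auto
qed

lemma T_pow_lower:
  assumes prim: "\<And>x y. x \<in> X \<Longrightarrow> y \<in> X \<Longrightarrow> (y, x) \<in> support ^^ m"
  shows "\<exists>\<delta>>0. \<forall>f. (\<forall>x\<in>X. f x \<ge> 0) \<longrightarrow> (\<forall>x\<in>X. (T ^^ m) f x \<ge> \<delta> * sum f X)"
proof (cases "X = {}")
  case True
  thus ?thesis by (intro exI[of _ 1]) auto
next
  case False
  have "\<forall>x\<in>X. \<forall>y\<in>X. \<exists>\<delta>>0. \<forall>f. (\<forall>x\<in>X. f x \<ge> 0) \<longrightarrow> (T ^^ m) f x \<ge> \<delta> * f y"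
    using T_pow_lower_path[OF prim] by blast
  then obtain d where d: "\<And>x y. x \<in> X \<Longrightarrow> y \<in> X \<Longrightarrow> d x y > 0"
    "\<And>x y f. x \<in> X \<Longrightarrow> y \<in> X \<Longrightarrow> \<forall>x\<in>X. f x \<ge> 0 \<Longrightarrow> (T ^^ m) f x \<ge> d x y * f y"
    by metis
  define \<delta> where "\<delta> = Min ((\<lambda>(x, y). d x y) ` (X \<times> X))"
  have fin: "finite ((\<lambda>(x, y). d x y) ` (X \<times> X))" "(\<lambda>(x, y). d x y) ` (X \<times> X) \<noteq> {}"
    using finite_X False by auto
  have "\<delta> > 0" unfolding \<delta>_def using fin d(1) by (subst Min_gr_iff) auto
  have le: "\<delta> \<le> d x y" if "x \<in> X" "y \<in> X" for x y
    unfolding \<delta>_def using fin that by (intro Min_le) auto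
  have card: "card X > 0" using False finite_X by (simp add: card_gt_0_iff)
  have "\<delta> / real (card X) * sum f X \<le> (T ^^ m) f x" if f: "\<forall>x\<in>X. f x \<ge> 0" and x: "x \<in> X" for f x
  proof -
    have "\<delta> * sum f X = (\<Sum>y\<in>X. \<delta> * f y)" by (simp add: sum_distrib_left)
    also have "\<dots> \<le> (\<Sum>y\<in>X. (T ^^ m) f x)"
      using d(2)[OF x _ f] le[OF x] f by (intro sum_mono) (meson mult_right_mono order_trans)
    also have "\<dots> = real (card X) * (T ^^ m) f x" by simp
    finally show ?thesis using card by (simp add: field_simps)
  qed
  moreover have "\<delta> / real (card X) > 0" using \<open>\<delta> > 0\<close> card by simp
  ultimately show ?thesis by blast
qed

text \<open>
  Write \<open>v = c u\<close>. The functions \<open>v - e\<close> and \<open>v + e\<close> are nonnegative and have the same sum as \<open>v\<close>, so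
  the \<open>m\<close>-th iterate sends both to functions that are at least \<open>d \<cdot> sum v\<close>, which in turn is at
  least \<open>\<delta>\<close> times the image of \<open>v\<close>.
\<close>
lemma contraction:
  assumes prim: "\<And>x y. x \<in> X \<Longrightarrow> y \<in> X \<Longrightarrow> (y, x) \<in> support ^^ m"
  shows "\<exists>\<delta>. 0 < \<delta> \<and> \<delta> < 1 \<and> (\<forall>u e c. (\<forall>x\<in>X. \<bar>e x\<bar> \<le> c * u x) \<and> sum e X = 0 \<longrightarrow>
           (\<forall>x\<in>X. \<bar>(T ^^ m) e x\<bar> \<le> (1 - \<delta>) * c * (T ^^ m) u x))"
proof -
  obtain d where d: "d > 0" "\<And>f x. \<forall>x\<in>X. f x \<ge> 0 \<Longrightarrow> x \<in> X \<Longrightarrow> (T ^^ m) f x \<ge> d * sum f X"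
    using T_pow_lower[OF prim] by blast
  obtain M where M: "M > 0" "\<And>f x. \<forall>x\<in>X. f x \<ge> 0 \<Longrightarrow> x \<in> X \<Longrightarrow> (T ^^ m) f x \<le> M * sum f X"
    using T_pow_upper by blast
  \<comment> \<open>The minimum with \<open>1 / 2\<close> keeps the contraction factor \<open>1 - \<delta>\<close> positive, so that its
     root is a legitimate rate.\<close>
  define \<delta> where "\<delta> = min (d / M) (1 / 2)"
  have \<delta>: "0 < \<delta>" "\<delta> < 1" "\<delta> * M \<le> d"
    using d(1) M(1) by (auto simp: \<delta>_def min_def field_simps)
  have "\<bar>(T ^^ m) e x\<bar> \<le> (1 - \<delta>) * c * (T ^^ m) u x"
    if e: "\<forall>x\<in>X. \<bar>e x\<bar> \<le> c * u x" and sum: "sum e X = 0" and x: "x \<in> X" for u e c x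
  proof -
    define v where "v = (\<lambda>x. c * u x)"
    have v: "\<forall>x\<in>X. v x \<ge> 0" using e by (force simp: v_def)
    have sv: "sum v X \<ge> 0" using v by (simp add: sum_nonneg)
    have "\<delta> * (T ^^ m) v x \<le> \<delta> * (M * sum v X)"
      using M(2)[OF v x] \<delta> by (intro mult_left_mono) auto
    also have "\<dots> \<le> d * sum v X" using mult_right_mono[OF \<delta>(3) sv] by simp
    finally have low: "\<delta> * (T ^^ m) v x \<le> d * sum v X" .
    have one_sided: "s * (T ^^ m) e x \<le> (1 - \<delta>) * (T ^^ m) v x" if "s \<in> {1, -1}" for s :: real
    proof -
      have "d * sum (\<lambda>x. v x - s * e x) X \<le> (T ^^ m) (\<lambda>x. v x - s * e x) x"
        using e that by (intro d(2) x) (fastforce simp: v_def abs_le_iff)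
      moreover have "sum (\<lambda>x. v x - s * e x) X = sum v X"
        using sum by (simp add: sum_subtractf sum_distrib_left[symmetric])
      ultimately have "d * sum v X \<le> (T ^^ m) v x - s * (T ^^ m) e x"
        by (simp add: T_pow_diff T_pow_scale)
      thus ?thesis using low by (simp add: algebra_simps)
    qed
    have "\<bar>(T ^^ m) e x\<bar> \<le> (1 - \<delta>) * (T ^^ m) v x"
      using one_sided[of 1] one_sided[of "-1"] by (simp add: abs_le_iff)
    thus ?thesis by (simp add: v_def T_pow_scale mult.assoc)
  qed
  thus ?thesis using \<delta> by blast
qed

text \<open>
  A single step preserves a bound \<open>\<bar>e\<bar> \<le> b u\<close> by the triangle inequality, and \<open>m\<close> steps improve it by
  \<open>1 - \<delta>\<close>. The rate is therefore the \<open>m\<close>-th root of \<open>1 - \<delta>\<close>, and dividing by \<open>1 - \<delta>\<close> pays for the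
  incomplete last block.
\<close>
theorem geometric_domination:
  assumes m: "m > 0"
    and prim: "\<And>x y. x \<in> X \<Longrightarrow> y \<in> X \<Longrightarrow> (y, x) \<in> support ^^ m"
    and u: "\<And>N x. x \<in> X \<Longrightarrow> u (Suc N) x = T (u N) x"
    and e: "\<And>N x. x \<in> X \<Longrightarrow> e (Suc N) x = T (e N) x"
    and e_sum: "\<And>N. sum (e N) X = 0"
    and init: "\<And>x. x \<in> X \<Longrightarrow> \<bar>e 0 x\<bar> \<le> c * u 0 x"
  shows "\<exists>r. 0 < r \<and> r < 1 \<and> (\<exists>C. \<forall>N. \<forall>x\<in>X. \<bar>e N x\<bar> \<le> C * r ^ N * u N x)"
proof -
  have pow: "w (N + l) x = (T ^^ l) (w N) x"
    if "\<And>N x. x \<in> X \<Longrightarrow> w (Suc N) x = T (w N) x" "x \<in> X" for w :: "nat \<Rightarrow> 'x \<Rightarrow> real" and N l x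
    using that(2)
  proof (induction l arbitrary: x)
    case (Suc l)
    have "w (N + Suc l) x = T (w (N + l)) x" using that(1) Suc.prems by simp
    also have "\<dots> = T ((T ^^ l) (w N)) x" using Suc.IH by (rule T_cong)
    finally show ?case by simp
  qed simp
  obtain \<delta> where \<delta>: "0 < \<delta>" "\<delta> < 1"
    and contr: "\<And>u e c x. \<forall>x\<in>X. \<bar>e x\<bar> \<le> c * u x \<Longrightarrow> sum e X = 0 \<Longrightarrow> x \<in> X \<Longrightarrow>
           \<bar>(T ^^ m) e x\<bar> \<le> (1 - \<delta>) * c * (T ^^ m) u x"
    using contraction[OF prim] by blast
  have jump: "\<forall>x\<in>X. \<bar>e (N + m) x\<bar> \<le> ((1 - \<delta>) * b) * u (N + m) x"
    if "\<forall>x\<in>X. \<bar>e N x\<bar> \<le> b * u N x" for N b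
    using contr[OF that e_sum] pow[of e] pow[of u] e u by simp
  have step: "\<forall>x\<in>X. \<bar>e (Suc N) x\<bar> \<le> b * u (Suc N) x"
    if "\<forall>x\<in>X. \<bar>e N x\<bar> \<le> b * u N x" for N b
  proof
    fix x assume x: "x \<in> X"
    have "\<bar>e (Suc N) x\<bar> \<le> (\<Sum>y\<in>X. \<bar>K y x * e N y\<bar>)"
      using e[OF x] sum_abs by (simp add: apply_kernel_def)
    also have "\<dots> \<le> (\<Sum>y\<in>X. K y x * (b * u N y))"
      using that by (intro sum_mono) (auto simp: abs_mult K_nonneg intro!: mult_left_mono)
    also have "\<dots> = b * u (Suc N) x"
      using u[OF x] by (simp add: apply_kernel_def sum_distrib_left algebra_simps)
    finally show "\<bar>e (Suc N) x\<bar> \<le> b * u (Suc N) x" .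
  qed
  have blocks: "\<forall>x\<in>X. \<bar>e (m * q + s) x\<bar> \<le> ((1 - \<delta>) ^ q * c) * u (m * q + s) x" for q s
  proof (induction s)
    case 0
    show ?case
    proof (induction q)
      case 0
      show ?case using init by simp
    next
      case (Suc q)
      show ?case using jump[OF Suc] by (simp add: algebra_simps)
    qed
  next
    case (Suc s)
    show ?case using step[OF Suc] by simp
  qed
  define r where "r = root m (1 - \<delta>)"
  have r: "0 < r" "r < 1" "r ^ m = 1 - \<delta>"
    using \<delta> m by (auto simp: r_def real_root_pow_pos2 real_root_lt_1_iff)
  have "\<bar>e N x\<bar> \<le> (c / (1 - \<delta>)) * r ^ N * u N x" if x: "x \<in> X" for N x
  proof -
    define q s where "q = N div m" and "s = N mod m"
    have N: "N = m * q + s" and s: "s < m" using m by (auto simp: q_def s_def)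
    have le: "\<bar>e N x\<bar> \<le> (1 - \<delta>) ^ q * (c * u N x)"
      using blocks x N by (simp add: mult.assoc)
    hence "0 \<le> (1 - \<delta>) ^ q * (c * u N x)" by linarith
    moreover have "0 < (1 - \<delta>) ^ q" using \<delta> by simp
    ultimately have cu: "0 \<le> c * u N x" by (metis linorder_not_le mult_pos_neg)
    have "(1 - \<delta>) ^ q * (1 - \<delta>) \<le> (1 - \<delta>) ^ q * r ^ s"
      using power_decreasing[of s m r] r s \<delta> by (intro mult_left_mono) auto
    also have "\<dots> = r ^ N" by (simp add: N power_add power_mult r(3))
    finally have "(1 - \<delta>) ^ q \<le> r ^ N / (1 - \<delta>)" using \<delta> by (simp add: field_simps)
    from mult_right_mono[OF this cu] show ?thesis using le by (simp add: algebra_simps)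
  qed
  thus ?thesis using r by blast
qed

end

section \<open>Counting walks by end vertex and product\<close>

lemma walks_snoc:
  assumes "vs \<noteq> []"
  shows "(vs @ [j], es @ [e]) \<in> walks G (Suc N) \<longleftrightarrow>
    (vs, es) \<in> walks G N \<and> j < nverts G \<and> e \<in> edges G \<and> ends G e = Upair (last vs) j"
proof (cases "length vs = Suc (length es)")
  case True
  hence "last vs = vs ! length es" using assms by (simp add: last_conv_nth)
  hence "(\<forall>i<Suc (length es). ends G ((es @ [e]) ! i) = Upair ((vs @ [j]) ! i) ((vs @ [j]) ! Suc i)) \<longleftrightarrow>
      (\<forall>i<length es. ends G (es ! i) = Upair (vs ! i) (vs ! Suc i)) \<and> ends G e = Upair (last vs) j"
    using True by (auto simp: All_less_Suc nth_append)
  thus ?thesis using True by (auto simp: walks_def)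
next
  case False
  thus ?thesis by (auto simp: walks_def)
qed

text \<open>The product reads only the vertices, so the two edge lists may be unrelated.\<close>
lemma walk_product_snoc:
  "walk_product \<Gamma> t (vs @ [j], es) = t j \<otimes>\<^bsub>\<Gamma>\<^esub> walk_product \<Gamma> t (vs, es')"
  by (simp add: walk_product_def)

lemma finite_walks:
  assumes "finite_multigraph G"
  shows "finite (walks G N)"
proof (rule finite_subset)
  show "walks G N \<subseteq> {vs. set vs \<subseteq> {..<nverts G} \<and> length vs = N} \<times>
                      {es. set es \<subseteq> edges G \<and> length es = N - 1}"
    by (auto simp: walks_def)
  show "finite ({vs. set vs \<subseteq> {..<nverts G} \<and> length vs = N} \<times>
                {es. set es \<subseteq> edges G \<and> length es = N - 1})"
    using assms by (intro finite_cartesian_product finite_lists_length_eq)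
      (auto simp: finite_multigraph_def)
qed

definition edges_between :: "'e multigraph \<Rightarrow> nat \<Rightarrow> nat \<Rightarrow> 'e set" where
  "edges_between G i j = {e \<in> edges G. ends G e = Upair i j}"

definition adjacency_relation :: "'e multigraph \<Rightarrow> (nat \<times> nat) set" where
  "adjacency_relation G = {(i, j). i < nverts G \<and> j < nverts G \<and> edges_between G i j \<noteq> {}}"

lemma sym_adjacency_relation: "sym (adjacency_relation G)"
proof -
  have "Upair i j = Upair j i" for i j :: nat by (simp add: Upair_inject)
  hence "edges_between G i j = edges_between G j i" for i j
    unfolding edges_between_def by (metis (no_types))
  thus ?thesis by (auto simp: sym_def adjacency_relation_def)
qed

text \<open>A nonzero entry of a power of the adjacency matrix has a nonzero summand, which yields a path.\<close>
lemma adjacency_power_nonzero: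
  assumes "i < nverts G" "j < nverts G" "(adjacency_matrix G ^\<^sub>m m) $$ (i, j) \<noteq> 0"
  shows "(i, j) \<in> adjacency_relation G ^^ m"
  using assms
proof (induction m arbitrary: j)
  case 0
  thus ?case by (auto simp: adjacency_matrix_def split: if_splits)
next
  case (Suc m)
  let ?n = "nverts G" and ?A = "adjacency_matrix G"
  have A: "?A \<in> carrier_mat ?n ?n" by (simp add: adjacency_matrix_def)
  hence "?A ^\<^sub>m m \<in> carrier_mat ?n ?n" by (rule pow_carrier_mat)
  hence "(?A ^\<^sub>m Suc m) $$ (i, j) = (\<Sum>l\<in>{0..<?n}. (?A ^\<^sub>m m) $$ (i, l) * ?A $$ (l, j))"
    using A Suc.prems by (simp add: scalar_prod_def)
  then obtain l where l: "l < ?n" "(?A ^\<^sub>m m) $$ (i, l) * ?A $$ (l, j) \<noteq> 0"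
    using Suc.prems(3) by (metis (no_types, lifting) atLeastLessThan_iff sum.neutral)
  hence "(?A ^\<^sub>m m) $$ (i, l) \<noteq> 0" and lj: "?A $$ (l, j) \<noteq> 0" by auto
  hence "(i, l) \<in> adjacency_relation G ^^ m" using Suc.IH Suc.prems(1) l(1) by simp
  moreover have "(l, j) \<in> adjacency_relation G"
  proof -
    have "?A $$ (l, j) = real (card (edges_between G l j))"
      using l(1) Suc.prems(2) by (simp add: adjacency_matrix_def edges_between_def)
    thus ?thesis using lj l(1) Suc.prems(2) by (auto simp: adjacency_relation_def)
  qed
  ultimately show ?case by auto
qed

lemma adjacency_relation_primitive:
  assumes "perron_frobenius_matrix (adjacency_matrix G)"
  shows "\<exists>k>0. adjacency_relation G ^^ k = {..<nverts G} \<times> {..<nverts G}"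
proof -
  let ?V = "{..<nverts G}" and ?R = "adjacency_relation G"
  obtain k where k: "k > 0" "\<And>i j. i < nverts G \<Longrightarrow> j < nverts G \<Longrightarrow> (adjacency_matrix G ^\<^sub>m k) $$ (i, j) > 0"
    using assms by (auto simp: perron_frobenius_matrix_def adjacency_matrix_def)
  have "?V \<times> ?V \<subseteq> ?R ^^ k"
  proof (clarify, goal_cases)
    case (1 i j)
    thus ?case using adjacency_power_nonzero[of i G j k] k(2)[of i j] by simp
  qed
  moreover have "?R ^^ k \<subseteq> ?V \<times> ?V"
  proof
    fix p assume p: "p \<in> ?R ^^ k"
    obtain i j where ij: "p = (i, j)" by fastforce
    have "(i, j) \<in> ?R ^^ Suc (k - 1)" using p k(1) ij by simp
    then obtain l l' where "(i, l) \<in> ?R" "(l', j) \<in> ?R" by (meson relpow_Suc_D2 relpow_Suc_E)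
    thus "p \<in> ?V \<times> ?V" by (auto simp: adjacency_relation_def ij)
  qed
  ultimately show ?thesis using k(1) by blast
qed

lemma perron_frobenius_adjacency_nonempty:
  assumes "perron_frobenius_matrix (adjacency_matrix G)"
  shows "nverts G > 0"
proof (rule ccontr)
  assume "\<not> nverts G > 0"
  then have "\<not> eigenvalue (map_mat complex_of_real (adjacency_matrix G)) z" for z
    by (auto simp: eigenvalue_def eigenvector_def adjacency_matrix_def)
  thus False using assms by (auto simp: perron_frobenius_matrix_def)
qed

text \<open>The walk-counting side of the skew product, with edge multiplicities as weights.\<close>
locale decorated_multigraph = group \<Gamma> for \<Gamma> :: "('g, 'b) monoid_scheme" (structure) +
  fixes G :: "'e multigraph" and t :: "nat \<Rightarrow> 'g"
  assumes finite_carrier: "finite (carrier \<Gamma>)"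
    and finite_G: "finite_multigraph G"
    and t_in: "\<And>i. i < nverts G \<Longrightarrow> t i \<in> carrier \<Gamma>"
begin

definition states :: "(nat \<times> 'g) set" where
  "states = {..<nverts G} \<times> carrier \<Gamma>"

definition walk_kernel :: "nat \<times> 'g \<Rightarrow> nat \<times> 'g \<Rightarrow> real" where
  "walk_kernel x y = (if snd y = t (fst y) \<otimes> snd x then real (card (edges_between G (fst x) (fst y))) else 0)"

definition walks_to :: "nat \<Rightarrow> nat \<times> 'g \<Rightarrow> (nat list \<times> 'e list) set" where
  "walks_to N x = {w \<in> walks G N. last (fst w) = fst x \<and> walk_product \<Gamma> t w = snd x}"

sublocale nonneg_kernel states walk_kernel
  by standard (auto simp: states_def walk_kernel_def finite_carrier)

lemma finite_edges_between: "finite (edges_between G i j)"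
  using finite_G by (simp add: edges_between_def finite_multigraph_def)

lemma finite_walks_to: "finite (walks_to N x)"
  using finite_walks[OF finite_G] by (simp add: walks_to_def)

lemma walk_product_in:
  assumes "w \<in> walks G N"
  shows "walk_product \<Gamma> t w \<in> carrier \<Gamma>"
proof -
  have "set vs \<subseteq> {..<nverts G} \<Longrightarrow> walk_product \<Gamma> t (vs, es) \<in> carrier \<Gamma>" for vs and es :: "'e list"
  proof (induction vs rule: rev_induct)
    case Nil
    then show ?case by (simp add: walk_product_def)
  next
    case (snoc v vs)
    then show ?case using t_in by (simp add: walk_product_snoc[of _ _ _ _ _ es])
  qed
  thus ?thesis using assms by (auto simp: walks_def)
qed

lemma walk_end_in:
  assumes "w \<in> walks G (Suc N)"
  shows "last (fst w) < nverts G"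
proof -
  have "last (fst w) \<in> set (fst w)"
    using assms by (intro last_in_set) (auto simp: walks_def)
  thus ?thesis using assms by (auto simp: walks_def)
qed

text \<open>
  A walk ending in \<open>y\<close> arises in exactly one way from a shorter walk, ending in some state \<open>x\<close>, by
  appending an edge from \<open>fst x\<close> to \<open>fst y\<close>; the product determines the group component of \<open>x\<close>.
  Lengths start at \<open>1\<close>, as the empty walk has no end vertex.
\<close>
lemma card_walks_to_Suc:
  assumes y: "y \<in> states"
  shows "real (card (walks_to (Suc (Suc N)) y)) =
         apply_kernel states walk_kernel (\<lambda>x. real (card (walks_to (Suc N) x))) y"
proof -
  obtain j g where jg: "y = (j, g)" "j < nverts G" using y by (auto simp: states_def)
  define X where "X = {x \<in> states. g = t j \<otimes> snd x}"
  define ext where "ext = (\<lambda>(x :: nat \<times> 'g, (vs, es), e :: 'e). (vs @ [j], es @ [e]))"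
  define D where "D = (SIGMA x:X. walks_to (Suc N) x \<times> edges_between G (fst x) j)"
  have ne: "vs \<noteq> []" if "(vs, es) \<in> walks G (Suc N)" for vs es
    using that by (auto simp: walks_def)
  have "bij_betw ext D (walks_to (Suc (Suc N)) y)"
  proof (rule bij_betw_imageI)
    show "inj_on ext D"
      by (rule inj_onI) (auto simp: ext_def D_def walks_to_def walk_product_def prod_eq_iff)
    show "ext ` D = walks_to (Suc (Suc N)) y"
    proof (intro equalityI subsetI)
      fix w assume "w \<in> ext ` D"
      then obtain x vs es e where d: "x \<in> X" "(vs, es) \<in> walks_to (Suc N) x"
        "e \<in> edges_between G (fst x) j" "w = (vs @ [j], es @ [e])"
        by (auto simp: ext_def D_def)
      then show "w \<in> walks_to (Suc (Suc N)) y"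
        using ne jg by (auto simp: walks_to_def walks_snoc X_def edges_between_def
            walk_product_snoc[of _ _ _ _ _ es])
    next
      fix w assume w: "w \<in> walks_to (Suc (Suc N)) y"
      obtain vs' es' where w_eq: "w = (vs', es')" by fastforce
      have "length vs' = Suc (Suc N)" "length es' = Suc N"
        using w by (auto simp: walks_to_def walks_def w_eq)
      then obtain vs v es e where snoc: "vs' = vs @ [v]" "es' = es @ [e]" "vs \<noteq> []"
        by (metis length_0_conv length_append_singleton nat.inject rev_exhaust old.nat.distinct(2))
      define x where "x = (last vs, walk_product \<Gamma> t (vs, es))"
      have vj: "v = j" using w by (simp add: walks_to_def w_eq snoc jg)
      have walk: "(vs, es) \<in> walks G (Suc N)" "e \<in> edges_between G (last vs) j"
        using w snoc(3) by (auto simp: walks_to_def w_eq snoc walks_snoc edges_between_def vj)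
      have "x \<in> X"
        using walk_product_in[OF walk(1)] walk_end_in[OF walk(1)] w
        by (auto simp: x_def X_def states_def walks_to_def w_eq snoc jg
            walk_product_snoc[of _ _ _ _ _ es])
      hence "(x, (vs, es), e) \<in> D"
        using walk by (auto simp: D_def walks_to_def x_def)
      moreover have "w = ext (x, (vs, es), e)" by (simp add: ext_def w_eq snoc vj)
      ultimately show "w \<in> ext ` D" by blast
    qed
  qed
  hence "card (walks_to (Suc (Suc N)) y) = card D" by (simp add: bij_betw_same_card)
  also have "card D = (\<Sum>x\<in>X. card (walks_to (Suc N) x \<times> edges_between G (fst x) j))"
    unfolding D_def using finite_X finite_walks_to finite_edges_between
    by (intro card_SigmaI) (auto simp: X_def)
  also have "real \<dots> = (\<Sum>x\<in>X. walk_kernel x y * real (card (walks_to (Suc N) x)))"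
    unfolding of_nat_sum
    by (intro sum.cong refl) (simp add: X_def walk_kernel_def jg card_cartesian_product)
  also have "\<dots> = (\<Sum>x\<in>states. walk_kernel x y * real (card (walks_to (Suc N) x)))"
    using finite_X by (intro sum.mono_neutral_left) (auto simp: X_def walk_kernel_def jg)
  finally show ?thesis by (simp add: apply_kernel_def)
qed

definition fibre_average :: "(nat \<times> 'g \<Rightarrow> real) \<Rightarrow> nat \<times> 'g \<Rightarrow> real" where
  "fibre_average f x = (\<Sum>h\<in>carrier \<Gamma>. f (fst x, h)) / real (card (carrier \<Gamma>))"

text \<open>Left translation by a decoration is a bijection of \<open>\<Gamma>\<close>: each vertex \<open>i\<close> contributes one state.\<close>
lemma apply_kernel_fibre:
  assumes j: "j < nverts G" and g: "g \<in> carrier \<Gamma>"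
  shows "apply_kernel states walk_kernel f (j, g) =
         (\<Sum>i<nverts G. real (card (edges_between G i j)) * f (i, inv (t j) \<otimes> g))"
proof -
  have iff: "g = t j \<otimes> h \<longleftrightarrow> h = inv (t j) \<otimes> g" if "h \<in> carrier \<Gamma>" for h
    using that g t_in[OF j] by (auto simp: m_assoc[symmetric])
  have "apply_kernel states walk_kernel f (j, g) =
        (\<Sum>i<nverts G. \<Sum>h\<in>carrier \<Gamma>. walk_kernel (i, h) (j, g) * f (i, h))"
    by (simp add: apply_kernel_def states_def sum.cartesian_product)
  also have "\<dots> = (\<Sum>i<nverts G. \<Sum>h\<in>carrier \<Gamma>. if h = inv (t j) \<otimes> g
                 then real (card (edges_between G i j)) * f (i, h) else 0)"
    by (intro sum.cong refl) (simp add: walk_kernel_def iff)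
  also have "\<dots> = (\<Sum>i<nverts G. real (card (edges_between G i j)) * f (i, inv (t j) \<otimes> g))"
    using finite_carrier g t_in[OF j] by simp
  finally show ?thesis .
qed

text \<open>
  The weights do not depend on the group component, and translating the fibre over \<open>i\<close> does not
  change the mean over it. So the averaged counts obey the same recurrence as the counts.
\<close>
lemma fibre_average_commutes:
  assumes x: "x \<in> states"
  shows "fibre_average (apply_kernel states walk_kernel f) x = apply_kernel states walk_kernel (fibre_average f) x"
proof -
  obtain j g where x_eq: "x = (j, g)" "j < nverts G" "g \<in> carrier \<Gamma>" using x by (auto simp: states_def)
  note tj = t_in[OF x_eq(2)]
  have bij: "bij_betw (\<lambda>h. inv (t j) \<otimes> h) (carrier \<Gamma>) (carrier \<Gamma>)"
    using tj by (intro bij_betw_byWitness[where f' = "\<lambda>h. t j \<otimes> h"]) (auto simp: m_assoc[symmetric])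
  have "(\<Sum>h\<in>carrier \<Gamma>. apply_kernel states walk_kernel f (j, h)) =
        (\<Sum>h\<in>carrier \<Gamma>. \<Sum>i<nverts G. real (card (edges_between G i j)) * f (i, inv (t j) \<otimes> h))"
    using x_eq by (intro sum.cong refl) (simp add: apply_kernel_fibre)
  also have "\<dots> = (\<Sum>i<nverts G. real (card (edges_between G i j)) * (\<Sum>h\<in>carrier \<Gamma>. f (i, inv (t j) \<otimes> h)))"
    by (subst sum.swap) (simp add: sum_distrib_left)
  also have "\<dots> = (\<Sum>i<nverts G. real (card (edges_between G i j)) * (\<Sum>h\<in>carrier \<Gamma>. f (i, h)))"
    using sum.reindex_bij_betw[OF bij, of "\<lambda>h. f (i, h)" for i] by simp
  finally have "fibre_average (apply_kernel states walk_kernel f) x =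
      (\<Sum>i<nverts G. real (card (edges_between G i j)) * (\<Sum>h\<in>carrier \<Gamma>. f (i, h))) / real (card (carrier \<Gamma>))"
    by (simp add: fibre_average_def x_eq)
  also have "\<dots> = (\<Sum>i<nverts G. real (card (edges_between G i j)) * fibre_average f (i, inv (t j) \<otimes> g))"
    unfolding fibre_average_def by (subst sum_divide_distrib) simp
  also have "\<dots> = apply_kernel states walk_kernel (fibre_average f) x"
    using x_eq by (simp add: apply_kernel_fibre)
  finally show ?thesis .
qed

lemma card_carrier_pos: "real (card (carrier \<Gamma>)) > 0"
  using finite_carrier by (auto simp: card_gt_0_iff)

lemma sum_fibre_average: "sum (fibre_average f) states = sum f states"
proof -
  have "sum (fibre_average f) states =
        (\<Sum>j<nverts G. \<Sum>g\<in>carrier \<Gamma>. (\<Sum>h\<in>carrier \<Gamma>. f (j, h)) / real (card (carrier \<Gamma>)))"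
    by (simp add: states_def fibre_average_def sum.cartesian_product')
  also have "\<dots> = (\<Sum>j<nverts G. \<Sum>h\<in>carrier \<Gamma>. f (j, h))"
    using card_carrier_pos by simp
  also have "\<dots> = sum f states" by (simp add: states_def sum.cartesian_product')
  finally show ?thesis .
qed

definition walk_count :: "nat \<Rightarrow> nat \<times> 'g \<Rightarrow> real" where
  "walk_count N x = real (card (walks_to N x))"

lemma card_walks_with_product:
  "real (card {w \<in> walks G (Suc N). walk_product \<Gamma> t w = g}) =
     (\<Sum>j<nverts G. walk_count (Suc N) (j, g))"
proof -
  have "{w \<in> walks G (Suc N). walk_product \<Gamma> t w = g} = (\<Union>j<nverts G. walks_to (Suc N) (j, g))"
    using walk_end_in by (auto simp: walks_to_def)
  also have "card \<dots> = (\<Sum>j<nverts G. card (walks_to (Suc N) (j, g)))"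
    using finite_walks_to by (intro card_UN_disjoint) (auto simp: walks_to_def)
  finally show ?thesis by (simp add: walk_count_def)
qed

lemma card_walks:
  "real (card (walks G (Suc N))) =
     real (card (carrier \<Gamma>)) * (\<Sum>j<nverts G. fibre_average (walk_count (Suc N)) (j, g))"
proof -
  have "walks G (Suc N) = (\<Union>h\<in>carrier \<Gamma>. {w \<in> walks G (Suc N). walk_product \<Gamma> t w = h})"
    using walk_product_in by auto
  also have "card \<dots> = (\<Sum>h\<in>carrier \<Gamma>. card {w \<in> walks G (Suc N). walk_product \<Gamma> t w = h})"
    using finite_walks[OF finite_G] finite_carrier by (intro card_UN_disjoint) auto
  finally have "real (card (walks G (Suc N))) = (\<Sum>h\<in>carrier \<Gamma>. \<Sum>j<nverts G. walk_count (Suc N) (j, h))"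
    by (simp add: card_walks_with_product)
  also have "\<dots> = (\<Sum>j<nverts G. \<Sum>h\<in>carrier \<Gamma>. walk_count (Suc N) (j, h))" by (rule sum.swap)
  finally show ?thesis
    using card_carrier_pos by (simp add: fibre_average_def sum_divide_distrib[symmetric])
qed

lemma walks_nonempty:
  assumes "nverts G > 0" and deg: "\<And>i. i < nverts G \<Longrightarrow> \<exists>j. (i, j) \<in> adjacency_relation G"
  shows "walks G (Suc N) \<noteq> {}"
proof (induction N)
  case 0
  have "([0], []) \<in> walks G (Suc 0)" using assms(1) by (simp add: walks_def)
  thus ?case by blast
next
  case (Suc N)
  then obtain vs es where w: "(vs, es) \<in> walks G (Suc N)" by auto
  then obtain j where "(last vs, j) \<in> adjacency_relation G"
    using deg walk_end_in by fastforce
  then obtain e where "j < nverts G" "e \<in> edges G" "ends G e = Upair (last vs) j"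
    by (auto simp: adjacency_relation_def edges_between_def)
  moreover have "vs \<noteq> []" using w by (auto simp: walks_def)
  ultimately have "(vs @ [j], es @ [e]) \<in> walks G (Suc (Suc N))" using w by (simp add: walks_snoc)
  thus ?case by blast
qed

text \<open>
  With \<open>a\<close> the walk counts and \<open>u\<close> their fibre averages, \<open>\<bar>a - u\<bar> \<le> C r\<^sup>N u\<close> pointwise. Summing over
  the end vertex and dividing by the number of walks, which is \<open>card (carrier \<Gamma>)\<close> times the sum of
  \<open>u\<close> over a horizontal slice, gives the estimate for the density.
\<close>
theorem walk_density_geometric:
  assumes "m > 0" and prim: "\<And>x y. x \<in> states \<Longrightarrow> y \<in> states \<Longrightarrow>
      (y, x) \<in> support ^^ m"
    and nonempty: "\<And>N. walks G (Suc N) \<noteq> {}"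
  shows "\<exists>r C. 0 < r \<and> r < 1 \<and> (\<forall>N. \<forall>g\<in>carrier \<Gamma>.
           \<bar>walk_density \<Gamma> G t (Suc N) g - 1 / real (card (carrier \<Gamma>))\<bar> \<le> C * r ^ N)"
proof -
  define a where "a N = walk_count (Suc N)" for N
  define u where "u N = fibre_average (a N)" for N
  have a_nonneg: "a N x \<ge> 0" for N x by (simp add: a_def walk_count_def)
  have a_Suc: "a (Suc N) x = apply_kernel states walk_kernel (a N) x" if "x \<in> states" for N x
    using card_walks_to_Suc[OF that] by (simp add: a_def walk_count_def[abs_def])
  have u_Suc: "u (Suc N) x = apply_kernel states walk_kernel (u N) x" if x: "x \<in> states" for N x
  proof -
    have "u (Suc N) x = fibre_average (apply_kernel states walk_kernel (a N)) x"
      using x a_Suc by (auto simp: u_def fibre_average_def states_def intro!: sum.cong)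
    thus ?thesis using fibre_average_commutes[OF x] by (simp add: u_def)
  qed
  let ?c = "real (card (carrier \<Gamma>))"
  have c1: "?c \<ge> 1" using card_carrier_pos by simp
  have init: "\<bar>a 0 x - u 0 x\<bar> \<le> ?c * u 0 x" if "x \<in> states" for x
  proof -
    have "a 0 x \<le> (\<Sum>h\<in>carrier \<Gamma>. a 0 (fst x, h))"
      using that finite_carrier a_nonneg
      member_le_sum[of "snd x" "carrier \<Gamma>" "\<lambda>h. a 0 (fst x, h)"] by (auto simp: states_def)
    also have "\<dots> = ?c * u 0 x" using card_carrier_pos by (simp add: u_def fibre_average_def)
    finally have "a 0 x \<le> ?c * u 0 x" .
    moreover have "0 \<le> u 0 x" using a_nonneg by (simp add: u_def fibre_average_def sum_nonneg)
    moreover from this have "u 0 x \<le> ?c * u 0 x" using c1 mult_right_mono[of 1 ?c "u 0 x"] by simp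
    ultimately show ?thesis using a_nonneg[of 0 x] by linarith
  qed
  define e where "e N x = a N x - u N x" for N x
  have e_Suc: "e (Suc N) x = apply_kernel states walk_kernel (e N) x" if "x \<in> states" for N x
    using a_Suc[OF that] u_Suc[OF that] T_diff by (simp add: e_def[abs_def])
  have e_sum: "sum (e N) states = 0" for N
    by (simp add: e_def sum_subtractf u_def sum_fibre_average)
  have e_init: "\<bar>e 0 x\<bar> \<le> ?c * u 0 x" if "x \<in> states" for x
    using init[OF that] by (simp add: e_def)
  obtain r C where r: "0 < r" "r < 1"
    and bound: "\<And>N x. x \<in> states \<Longrightarrow> \<bar>a N x - u N x\<bar> \<le> C * r ^ N * u N x"
    using geometric_domination[OF \<open>m > 0\<close> prim u_Suc e_Suc e_sum e_init]
    unfolding e_def by blast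
  have "\<bar>walk_density \<Gamma> G t (Suc N) g - 1 / ?c\<bar> \<le> C / ?c * r ^ N" if g: "g \<in> carrier \<Gamma>" for N g
  proof -
    define U where "U = (\<Sum>j<nverts G. u N (j, g))"
    have walks_U: "real (card (walks G (Suc N))) = ?c * U"
      by (simp add: U_def u_def a_def card_walks)
    have "card (walks G (Suc N)) > 0"
      using nonempty finite_walks[OF finite_G] by (simp add: card_gt_0_iff)
    hence "?c * U > 0" using walks_U by (metis of_nat_0_less_iff)
    hence U: "U > 0" using c1 by (simp add: zero_less_mult_iff)
    have "walk_density \<Gamma> G t (Suc N) g - 1 / ?c = ((\<Sum>j<nverts G. a N (j, g)) - U) / (?c * U)"
      unfolding walk_density_def walks_U card_walks_with_product a_def[symmetric]
      using U card_carrier_pos by (simp add: field_simps)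
    also have "\<bar>\<dots>\<bar> = \<bar>\<Sum>j<nverts G. a N (j, g) - u N (j, g)\<bar> / (?c * U)"
      using U by (simp add: U_def sum_subtractf abs_mult)
    also have "\<dots> \<le> (\<Sum>j<nverts G. C * r ^ N * u N (j, g)) / (?c * U)"
      using U g by (intro divide_right_mono order_trans[OF sum_abs] sum_mono bound)
        (auto simp: states_def)
    also have "\<dots> = C * r ^ N * U / (?c * U)" by (simp add: U_def sum_distrib_left)
    also have "\<dots> = C / ?c * r ^ N" using U by simp
    finally show ?thesis .
  qed
  thus ?thesis using r by blast
qed

end

section \<open>Equidistribution\<close>

text \<open>
  For large \<open>N\<close> half of the decay \<open>r = s\<^sup>2\<close> is spent on killing the constant, leaving \<open>s\<^sup>N\<close>. For the
  finitely many small \<open>N\<close> the uniform bound \<open>b < 1\<close> suffices, provided that \<open>c\<close> is so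
  close to \<open>1\<close> that even \<open>c\<^sup>n\<close> exceeds it, where \<open>n\<close> is the point from which \<open>N\<close> counts as large.
\<close>
lemma geometric_bound_absorbs_constants:
  fixes p :: "nat \<Rightarrow> 'a \<Rightarrow> real"
  assumes r: "0 < r" "r < 1" and b: "b < 1"
    and geo: "\<And>N g. g \<in> A \<Longrightarrow> p (Suc N) g \<le> C * r ^ N"
    and bound: "\<And>N g. g \<in> A \<Longrightarrow> p N g \<le> b"
  shows "\<exists>c<1. \<forall>N\<ge>1. \<forall>g\<in>A. p N g < c ^ N"
proof -
  define s where "s = sqrt r"
  have s: "0 < s" "s < 1" "r = s * s" using r by (auto simp: s_def)
  have "(\<lambda>N. (C / r) * s ^ N) \<longlonglongrightarrow> (C / r) * 0"
    using s by (intro tendsto_mult tendsto_const LIMSEQ_power_zero) simp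
  hence "eventually (\<lambda>N. (C / r) * s ^ N < 1) sequentially"
    by (auto dest: order_tendstoD(2)[where a = 1])
  then obtain N0 where N0: "\<And>N. N \<ge> N0 \<Longrightarrow> (C / r) * s ^ N < 1"
    by (auto simp: eventually_sequentially)
  define n where "n = Suc N0"
  define \<beta> where "\<beta> = (1 + max b 0) / 2"
  have \<beta>: "0 < \<beta>" "\<beta> < 1" "b < \<beta>" using b by (auto simp: \<beta>_def max_def field_simps)
  define c where "c = max s (root n \<beta>)"
  have c: "0 < c" "c < 1"
    using s \<beta> by (auto simp: c_def n_def real_root_lt_1_iff max_def)
  have "p N g < c ^ N" if N: "N \<ge> 1" and g: "g \<in> A" for N g
  proof (cases "N \<ge> n")
    case True
    obtain M where M: "N = Suc M" using N by (cases N) auto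
    have "p N g \<le> C * r ^ M" using geo[OF g] M by simp
    also have "\<dots> = ((C / r) * s ^ N) * s ^ N"
      using r(1) s by (simp add: M power_mult_distrib field_simps)
    also have "\<dots> < 1 * s ^ N"
      using N0[of N] True s(1) by (intro mult_strict_right_mono) (auto simp: n_def)
    also have "\<dots> \<le> c ^ N" using s by (simp add: c_def power_mono)
    finally show ?thesis .
  next
    case False
    have "p N g < \<beta>" using bound[OF g, of N] \<beta>(3) by simp
    also have "\<beta> = root n \<beta> ^ n"
      using \<beta> real_root_pow_pos2[of n \<beta>] by (simp add: n_def)
    also have "\<dots> \<le> c ^ n" using \<beta> by (intro power_mono) (auto simp: c_def n_def)
    also have "\<dots> \<le> c ^ N" using c False by (intro power_decreasing) auto
    finally show ?thesis .
  qed
  thus ?thesis using c by blast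
qed

lemma measure_walk_distribution:
  assumes "finite (carrier \<Gamma>)" "S \<subseteq> carrier \<Gamma>"
  shows "measure (walk_distribution \<Gamma> G t N) S = (\<Sum>g\<in>S. walk_density \<Gamma> G t N g)"
proof -
  have nonneg: "walk_density \<Gamma> G t N g \<ge> 0" for g by (simp add: walk_density_def)
  have "emeasure (walk_distribution \<Gamma> G t N) S = (\<Sum>g\<in>S. ennreal (walk_density \<Gamma> G t N g))"
    using assms by (simp add: walk_distribution_def emeasure_point_measure_finite)
  also have "\<dots> = ennreal (\<Sum>g\<in>S. walk_density \<Gamma> G t N g)"
    using nonneg by simp
  finally show ?thesis using nonneg by (simp add: measure_def sum_nonneg)
qed

theorem theorem11p2:
  fixes \<Gamma> :: "('g, 'b) monoid_scheme"
    and G :: "'e multigraph"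
    and t :: "nat \<Rightarrow> 'g"
  assumes "group \<Gamma>" and "finite (carrier \<Gamma>)"
    and "finite_multigraph G"
    and "t ` {..<nverts G} \<subseteq> carrier \<Gamma>"
    and "generate \<Gamma> (t ` {..<nverts G}) = carrier \<Gamma>"
    and "perron_frobenius_matrix (adjacency_matrix G)"
    and "\<And>\<rho>. one_dim_unitary_rep \<Gamma> \<rho> \<Longrightarrow> nontrivial_rep \<Gamma> \<rho> \<Longrightarrow>
           \<exists>i<nverts G. \<exists>j<nverts G. \<rho> (t i) \<noteq> \<rho> (t j)"
  shows "(\<forall>S\<subseteq>carrier \<Gamma>. (\<lambda>N. measure (walk_distribution \<Gamma> G t N) S)
            \<longlonglongrightarrow> measure (uniform_count_measure (carrier \<Gamma>)) S) \<and>
         (\<exists>c<1::real. \<forall>N\<ge>1. \<forall>g\<in>carrier \<Gamma>.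
            walk_density \<Gamma> G t N g - 1 / real (card (carrier \<Gamma>)) < c ^ N)"
proof -
  let ?V = "{..<nverts G}" and ?E = "adjacency_relation G" and ?c = "real (card (carrier \<Gamma>))"
  interpret group \<Gamma> by fact
  have V: "nverts G > 0" by (rule perron_frobenius_adjacency_nonempty) fact
  obtain k where k: "k > 0" "?E ^^ k = ?V \<times> ?V"
    using adjacency_relation_primitive[OF assms(6)] by blast
  interpret W: decorated_multigraph \<Gamma> G t
    using assms(2-4) by unfold_locales auto
  interpret S: skew_product \<Gamma> ?V ?E t k
  proof
    show "?E \<subseteq> ?V \<times> ?V" by (auto simp: adjacency_relation_def)
    fix H assume H: "H \<lhd> \<Gamma>" "\<And>i j. i \<in> ?V \<Longrightarrow> j \<in> ?V \<Longrightarrow> t i \<otimes>\<^bsub>\<Gamma>\<^esub> inv\<^bsub>\<Gamma>\<^esub> t j \<in> H"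
    show "H = carrier \<Gamma>"
    proof (rule normal_subgroup_eq_carrier[OF assms(2,4,5) H(1)])
      fix \<rho> assume "\<rho> \<in> hom \<Gamma> circle_group" "\<exists>g\<in>carrier \<Gamma>. \<rho> g \<noteq> 1"
      thus "\<exists>x\<in>t ` ?V. \<exists>y\<in>t ` ?V. \<rho> x \<noteq> \<rho> y"
        using assms(7)[of \<rho>] by (auto simp: one_dim_unitary_rep_def nontrivial_rep_def)
    qed (use H(2) in auto)
  qed (use assms(2,4,5) k sym_adjacency_relation in auto)
  have step_eq: "S.step = W.support"
    unfolding S.step_def W.support_def using W.t_in W.finite_edges_between
    by (auto simp: W.states_def W.walk_kernel_def adjacency_relation_def card_gt_0_iff
        split: if_splits)
  obtain m where m: "m > 0" "\<And>x y. x \<in> W.states \<Longrightarrow> y \<in> W.states \<Longrightarrow> (x, y) \<in> S.step ^^ m"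
    using S.step_primitive unfolding W.states_def by blast
  have "\<exists>j. (i, j) \<in> ?E" if "i < nverts G" for i
  proof -
    have "(i, i) \<in> ?E ^^ Suc (k - 1)" using k that by simp
    thus ?thesis by (meson relpow_Suc_D2)
  qed
  hence nonempty: "walks G (Suc N) \<noteq> {}" for N using W.walks_nonempty V by blast
  obtain r C where r: "0 < r" "r < 1" and geo: "\<And>N g. g \<in> carrier \<Gamma> \<Longrightarrow>
      \<bar>walk_density \<Gamma> G t (Suc N) g - 1 / ?c\<bar> \<le> C * r ^ N"
    using W.walk_density_geometric[OF m(1) m(2)[unfolded step_eq] nonempty] by blast
  have conv: "(\<lambda>N. walk_density \<Gamma> G t N g) \<longlonglongrightarrow> 1 / ?c" if g: "g \<in> carrier \<Gamma>" for g
  proof -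
    have "(\<lambda>N. C * r ^ N) \<longlonglongrightarrow> C * 0"
      using r by (intro tendsto_mult tendsto_const LIMSEQ_power_zero) simp
    hence lim: "(\<lambda>N. C * r ^ N) \<longlonglongrightarrow> 0" by simp
    have "eventually (\<lambda>N. norm (walk_density \<Gamma> G t (Suc N) g - 1 / ?c) \<le> C * r ^ N) sequentially"
      using geo[OF g] by (intro eventuallyI) simp
    hence "(\<lambda>N. walk_density \<Gamma> G t (Suc N) g - 1 / ?c) \<longlonglongrightarrow> 0"
      using lim by (rule Lim_null_comparison)
    hence "(\<lambda>N. walk_density \<Gamma> G t (Suc N) g) \<longlonglongrightarrow> 1 / ?c" by (simp add: LIM_zero_iff)
    thus ?thesis by (rule LIMSEQ_imp_Suc)
  qed
  have "(\<lambda>N. measure (walk_distribution \<Gamma> G t N) S)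
            \<longlonglongrightarrow> measure (uniform_count_measure (carrier \<Gamma>)) S" if S: "S \<subseteq> carrier \<Gamma>" for S
  proof -
    have "(\<lambda>N. \<Sum>g\<in>S. walk_density \<Gamma> G t N g) \<longlonglongrightarrow> (\<Sum>g\<in>S. 1 / ?c)"
      using conv S by (intro tendsto_sum) auto
    thus ?thesis
      using S assms(2) by (simp add: measure_walk_distribution measure_uniform_count_measure)
  qed
  moreover have "\<exists>c<1. \<forall>N\<ge>1. \<forall>g\<in>carrier \<Gamma>. walk_density \<Gamma> G t N g - 1 / ?c < c ^ N"
  proof (rule geometric_bound_absorbs_constants[OF r])
    show "1 - 1 / ?c < 1" using W.card_carrier_pos by simp
    fix g assume g: "g \<in> carrier \<Gamma>"
    show "walk_density \<Gamma> G t (Suc N) g - 1 / ?c \<le> C * r ^ N" for N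
      using geo[OF g, of N] by linarith
    have "card {w \<in> walks G N. walk_product \<Gamma> t w = g} \<le> card (walks G N)" for N
      using finite_walks[OF assms(3)] by (intro card_mono) auto
    hence "walk_density \<Gamma> G t N g \<le> 1" for N
      by (auto simp: walk_density_def divide_le_eq_1)
    thus "walk_density \<Gamma> G t N g - 1 / ?c \<le> 1 - 1 / ?c" for N by simp
  qed
  ultimately show ?thesis by blast
qed

end
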